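(* Let $T\in[1,+\infty]$ be a random variable with distribution $p$ on $[1,+\infty]$ (the running time of a Las Vegas algorithm). Let $q\in(0,1]$ and let $S^q$ be the cutoff sequence defined by $S^q_k=\left(1-\frac{q}{2}\right)^{-k}$ for all $k\geq 0$. Then \[ \mathcal{U}_p(S^q)\;\leq\;4\,\frac{Q_p(q)}{q}. \]
   Context: Restart setup: a Las Vegas algorithm has random running time $T\in[1,+\infty]$ with distribution $p$ ($T=+\infty$ means non-termination). Given a cutoff sequence $S=(S_0,S_1,\dots)\in[1,+\infty)^{\mathbb N}$, the multi-start algorithm runs the algorithm successively with cutoffs $S_0,S_1,\dots$: at round $k$ it runs a fresh independent copy with running time $T_k$ ($T_0,T_1,\dots$ i.i.d. with distribution $p$) for at most time $S_k$, stopping at the first round where the copy terminates. Let $K^\star=\min\{k\geq 0: T_k\leq S_k\}$. The expected running time is $\mathcal{L}_p(S)=\mathbb{E}\big[\sum_{k=0}^{K^\star-1}S_k+T_{K^\star}\big]$ and the expected total cutoff is $\mathcal{U}_p(S)=\mathbb{E}\big[\sum_{k=0}^{K^\star}S_k\big]$ (both $+\infty$ if $K^\star$ is infinite with positive probability). The $q$-quantile is $Q_p(q)=\min\{\alpha\in[1,+\infty]:\mathbb{P}(T\leq\alpha)\geq q\}$ for $q\in(0,1]$. *)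

theory Defs
  imports "HOL-Probability.Probability"
begin

text \<open>
  Running times live in \<^typ>\<open>ennreal\<close>, with \<open>\<infinity>\<close> for non-termination; their distribution is a
  Borel probability measure on \<^typ>\<open>ennreal\<close>. Cutoff sequences are real-valued.
\<close>

definition stop_round :: "(nat \<Rightarrow> real) \<Rightarrow> (nat \<Rightarrow> ennreal) \<Rightarrow> enat" where
  "stop_round S t = (INF k\<in>{k. t k \<le> ennreal (S k)}. enat k)"

definition total_cutoff :: "(nat \<Rightarrow> real) \<Rightarrow> (nat \<Rightarrow> ennreal) \<Rightarrow> ennreal" where
  "total_cutoff S t =
     (case stop_round S t of enat n \<Rightarrow> (\<Sum>k\<le>n. ennreal (S k)) | \<infinity> \<Rightarrow> \<infinity>)"

text \<open>
  The i.i.d. sequence of running times is realised as the coordinates of the infinite product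
  of \<open>p\<close> with itself.
\<close>

definition expected_total_cutoff :: "ennreal measure \<Rightarrow> (nat \<Rightarrow> real) \<Rightarrow> ennreal" where
  "expected_total_cutoff p S = (\<integral>\<^sup>+ t. total_cutoff S t \<partial>(\<Pi>\<^sub>M k\<in>UNIV. p))"

definition quantile :: "ennreal measure \<Rightarrow> real \<Rightarrow> ennreal" where
  "quantile p q = (LEAST \<alpha>. 1 \<le> \<alpha> \<and> q \<le> measure p {..\<alpha>})"

definition geometric_cutoffs :: "real \<Rightarrow> nat \<Rightarrow> real" where
  "geometric_cutoffs q k = (1 - q / 2) powi (- int k)"

text \<open>
  The two definitions above that could degenerate (an integral of a non-measurable function, a
  \<open>LEAST\<close> that is not attained) do not do so.
\<close>

lemma borel_measurable_total_cutoff: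
  assumes [measurable_cong]: "sets p = sets borel"
  shows "total_cutoff S \<in> borel_measurable (\<Pi>\<^sub>M k\<in>UNIV. p)"
proof -
  have [measurable]: "stop_round S \<in> measurable (\<Pi>\<^sub>M k\<in>UNIV. p) (count_space UNIV)"
  proof -
    have eq: "stop_round S =
        (\<lambda>t. if \<exists>k. t k \<le> ennreal (S k) then enat (LEAST k. t k \<le> ennreal (S k)) else \<infinity>)"
    proof
      fix t
      show "stop_round S t =
        (if \<exists>k. t k \<le> ennreal (S k) then enat (LEAST k. t k \<le> ennreal (S k)) else \<infinity>)"
      proof (cases "\<exists>k. t k \<le> ennreal (S k)")
        case True
        then have "t (LEAST k. t k \<le> ennreal (S k)) \<le> ennreal (S (LEAST k. t k \<le> ennreal (S k)))"
          by (rule LeastI_ex)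
        then show ?thesis
          using True unfolding stop_round_def
          by (auto intro!: antisym INF_lower INF_greatest Least_le)
      next
        case False
        then show ?thesis
          by (simp add: stop_round_def top_enat_def)
      qed
    qed
    show ?thesis
      unfolding eq by measurable
  qed
  have "(\<lambda>t. (case stop_round S t of enat n \<Rightarrow> (\<Sum>k\<le>n. ennreal (S k)) | \<infinity> \<Rightarrow> \<infinity>))
      \<in> borel_measurable (\<Pi>\<^sub>M k\<in>UNIV. p)"
    by measurable
  then show ?thesis
    by (simp add: total_cutoff_def[abs_def])
qed

lemma quantile_attained:
  assumes "prob_space p" and sets_p: "sets p = sets borel" and "q \<le> 1"
  shows "1 \<le> quantile p q \<and> q \<le> measure p {..quantile p q}"
proof -
  interpret prob_space p by fact
  define A where "A = {\<alpha>. 1 \<le> \<alpha> \<and> q \<le> measure p {..\<alpha>}}"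
  have space_p: "space p = UNIV"
    using sets_eq_imp_space_eq[OF sets_p] by simp
  have "{..\<infinity>} = (UNIV :: ennreal set)"
    by auto
  then have "\<infinity> \<in> A"
    using \<open>q \<le> 1\<close> prob_space space_p by (simp add: A_def)
  then have "A \<noteq> {}" by auto
  then obtain f :: "nat \<Rightarrow> ennreal" where f: "decseq f" "range f \<subseteq> A" "Inf A = (INF i. f i)"
    using ennreal_Inf_countable_INF by blast
  have "(\<Inter>i. {..f i}) = {..Inf A}"
    by (auto simp: f(3) le_INF_iff)
  moreover have "(\<lambda>i. measure p {..f i}) \<longlonglongrightarrow> measure p (\<Inter>i. {..f i})"
    using f(1) by (intro finite_Lim_measure_decseq) (auto simp: sets_p decseq_def intro: order_trans)
  ultimately have "(\<lambda>i. measure p {..f i}) \<longlonglongrightarrow> measure p {..Inf A}"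
    by simp
  then have "q \<le> measure p {..Inf A}"
    by (rule LIMSEQ_le_const) (use f(2) in \<open>auto simp: A_def\<close>)
  moreover have "1 \<le> Inf A"
    by (auto simp: A_def intro!: Inf_greatest)
  ultimately have "1 \<le> Inf A \<and> q \<le> measure p {..Inf A}"
    by simp
  then show ?thesis
    unfolding quantile_def
    by (rule LeastI2_order) (auto simp: A_def intro: Inf_lower)
qed

end

theory Submission
  imports Defs
begin

text \<open>
  The cutoff of round \<open>k\<close> is paid exactly when all earlier rounds fail, so the expected total
  cutoff of \<open>S\<close> is \<open>\<Sum>k. S k * (\<Prod>j<k. \<P>(T > S j))\<close>. Write \<open>r = 1 - q/2\<close>, and let \<open>m\<close> be the first
  round whose cutoff \<open>r\<^sup>-\<^sup>m\<close> reaches the quantile \<open>Q\<close>. Every round from \<open>m\<close> on fails with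
  probability at most \<open>1 - q\<close>, so the \<open>k\<close>-th term is at most \<open>r\<^sup>-\<^sup>k (1 - q)\<^sup>k\<^sup>-\<^sup>m\<close> (at most \<open>r\<^sup>-\<^sup>k\<close> for
  \<open>k < m\<close>). Since \<open>1 - (1 - q)/r = q/(2r)\<close> and \<open>1/r - 1 = q/(2r)\<close>, the geometric series after and
  before \<open>m\<close> contribute at most \<open>2r r\<^sup>-\<^sup>m/q\<close> each, and \<open>r r\<^sup>-\<^sup>m \<le> Q\<close> by minimality of \<open>m\<close>.
\<close>

lemma stop_round_eq_enat:
  assumes "t n \<le> ennreal (S n)" and "\<And>k. k < n \<Longrightarrow> ennreal (S k) < t k"
  shows "stop_round S t = enat n"
  unfolding stop_round_def
  using assms by (intro antisym INF_lower INF_greatest) (auto simp: not_less[symmetric])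

text \<open>Round \<open>k\<close> is paid exactly when rounds \<open>0, ..., k - 1\<close> all
  fail, which is the event in the indicator. Writing the cost as a series of such terms allows
  integration term by term.\<close>

lemma total_cutoff_eq_suminf:
  assumes "\<And>k. 1 \<le> S k"
  shows "total_cutoff S t =
    (\<Sum>k. ennreal (S k) * indicator {t. \<forall>j\<in>{..<k}. t j \<in> {ennreal (S j)<..}} t)"
proof (cases "\<exists>k. t k \<le> ennreal (S k)")
  case True
  define n where "n = (LEAST k. t k \<le> ennreal (S k))"
  have n: "t n \<le> ennreal (S n)"
    unfolding n_def using True by (rule LeastI_ex)
  have less: "ennreal (S k) < t k" if "k < n" for k
    using not_less_Least[OF that[unfolded n_def]] by simp
  \<comment> \<open>Terms beyond \<open>n\<close> vanish, since their events require round
    \<open>n\<close> to fail.\<close>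
  have "(\<Sum>k. ennreal (S k) * indicator {t. \<forall>j\<in>{..<k}. t j \<in> {ennreal (S j)<..}} t)
      = (\<Sum>k\<le>n. ennreal (S k) * indicator {t. \<forall>j\<in>{..<k}. t j \<in> {ennreal (S j)<..}} t)"
    using n by (intro suminf_finite) (auto simp: indicator_def not_le dest: leD)
  also have "\<dots> = (\<Sum>k\<le>n. ennreal (S k))"
    using less by (intro sum.cong) (auto simp: indicator_def)
  finally show ?thesis
    by (simp add: total_cutoff_def stop_round_eq_enat[where t = t and S = S, OF n less])
next
  case False
  then have "stop_round S t = \<infinity>"
    by (simp add: stop_round_def top_enat_def)
  \<comment> \<open>If no round succeeds, every indicator is 1; cutoffs of at least 1 make the
    series diverge, in agreement with the value \<open>\<infinity>\<close> of
    \<open>total_cutoff\<close>.\<close>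
  moreover have "(\<Sum>k. ennreal (S k)) = \<infinity>"
  proof -
    have "\<infinity> = (\<Sum>k::nat. 1 :: ennreal)"
      by (simp add: suminf_eq_SUP ennreal_SUP_of_nat_eq_top)
    also have "\<dots> \<le> (\<Sum>k. ennreal (S k))"
      using assms by (intro suminf_le) auto
    finally show ?thesis
      by (simp add: top_unique)
  qed
  ultimately show ?thesis
    using False by (simp add: total_cutoff_def indicator_def not_le)
qed

text \<open>Monotone convergence exchanges sum and integral. Each event restricts finitely many
  coordinates, so independence turns its probability into a finite product.\<close>

lemma expected_total_cutoff_eq_suminf:
  assumes "prob_space p" and sets_p: "sets p = sets borel" and "\<And>k. 1 \<le> S k"
  shows "expected_total_cutoff p S =
    (\<Sum>k. ennreal (S k) * (\<Prod>j<k. emeasure p {ennreal (S j)<..}))"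
proof -
  interpret prob_space p by fact
  interpret product_prob_space "\<lambda>_::nat. p" UNIV
    by (intro product_prob_spaceI) (rule assms)
  have space_p: "space p = UNIV"
    using sets_eq_imp_space_eq[OF sets_p] by simp
  let ?A = "\<lambda>k. {t. \<forall>j\<in>{..<k}. t j \<in> {ennreal (S j)<..}}"
  have space_Pi: "space (\<Pi>\<^sub>M k\<in>(UNIV::nat set). p) = UNIV"
    by (simp add: space_PiM space_p)
  have A_eq: "?A k = {t \<in> space (\<Pi>\<^sub>M k\<in>(UNIV::nat set). p). \<forall>j\<in>{..<k}. t j \<in> {ennreal (S j)<..}}"
    for k by (simp add: space_Pi)
  have [measurable]: "{ennreal (S j)<..} \<in> sets p" for j
    by (simp add: sets_p)
  have A_sets [measurable]: "?A k \<in> sets (\<Pi>\<^sub>M k\<in>UNIV. p)" for k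
    unfolding A_eq by measurable
  have "emeasure (\<Pi>\<^sub>M k\<in>UNIV. p) (?A k) = (\<Prod>j<k. emeasure p {ennreal (S j)<..})" for k
    unfolding A_eq by (rule emeasure_PiM_Collect) auto
  then show ?thesis
    unfolding expected_total_cutoff_def total_cutoff_eq_suminf[OF assms(3)]
    by (subst nn_integral_suminf) (measurable, simp only: nn_integral_cmult_indicator A_sets)
qed

text \<open>Factors before \<open>m\<close> are bounded by 1, the later ones by \<open>c\<close>.
  Truncated subtraction makes the exponent 0 for \<open>k \<le> m\<close>.\<close>

lemma prod_le_power_diff:
  fixes f :: "nat \<Rightarrow> ennreal"
  assumes "\<And>j. f j \<le> 1" and "\<And>j. m \<le> j \<Longrightarrow> f j \<le> c"
  shows "(\<Prod>j<k. f j) \<le> c ^ (k - m)"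
proof (induction k)
  case (Suc k)
  show ?case
  proof (cases "m \<le> k")
    case True
    then show ?thesis
      using mult_mono[OF Suc assms(2)[OF True]] by (simp add: Suc_diff_le mult.commute)
  next
    case False
    then show ?thesis
      using mult_mono[OF Suc assms(1)[of k]] by simp
  qed
qed simp

lemma delayed_geometric_sums:
  fixes q r :: real
  assumes "0 < q" and "q \<le> 1" and r: "r = 1 - q / 2"
  shows "(\<lambda>k. (1 / r) ^ k * (1 - q) ^ (k - m)) sums (2 * r / q * (2 * (1 / r) ^ m - 1))"
proof -
  have "0 < r" and "r < 1"
    using assms by auto
  have "(\<lambda>i. (1 / r) ^ m * ((1 - q) / r) ^ i) sums ((1 / r) ^ m * (1 / (1 - (1 - q) / r)))"
    using assms \<open>0 < r\<close> by (intro sums_mult geometric_sums) simp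
  moreover have "1 / (1 - (1 - q) / r) = 2 * r / q"
  proof -
    have "1 - q = r - q / 2"
      by (simp add: r)
    then show ?thesis
      using \<open>0 < r\<close> by (simp add: diff_divide_distrib)
  qed
  ultimately have "(\<lambda>i. (1 / r) ^ (i + m) * (1 - q) ^ (i + m - m)) sums ((1 / r) ^ m * (2 * r / q))"
    by (simp add: power_add power_divide mult.commute)
  \<comment> \<open>Here \<open>k - m = 0\<close>, so the second factor is 1, also for
    \<open>q = 1\<close> because \<open>0 ^ 0 = 1\<close>.\<close>
  moreover have "(\<Sum>k<m. (1 / r) ^ k * (1 - q) ^ (k - m)) = ((1 / r) ^ m - 1) * (2 * r / q)"
  proof -
    have "(\<Sum>k<m. (1 / r) ^ k * (1 - q) ^ (k - m)) = (\<Sum>k<m. (1 / r) ^ k)"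
      by (intro sum.cong) auto
    also have "\<dots> = ((1 / r) ^ m - 1) / (1 / r - 1)"
      using \<open>r < 1\<close> \<open>0 < r\<close> by (intro geometric_sum) simp
    also have "1 / r - 1 = q / (2 * r)"
    proof -
      have "q = 2 - 2 * r"
        by (simp add: r)
      then show ?thesis
        using \<open>0 < r\<close> by (simp add: diff_divide_distrib)
    qed
    finally show ?thesis
      by simp
  qed
  ultimately have "(\<lambda>k. (1 / r) ^ k * (1 - q) ^ (k - m)) sums
      ((1 / r) ^ m * (2 * r / q) + ((1 / r) ^ m - 1) * (2 * r / q))"
    by (subst (asm) sums_iff_shift) simp
  then show ?thesis
    by (simp add: algebra_simps diff_divide_distrib)
qed

text \<open>The least suitable exponent overshoots \<open>x\<close> by at most one factor
  \<open>b\<close>, because the preceding power is still below \<open>x\<close>. For exponent 0 the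
  bound comes from \<open>1 \<le> x\<close>.\<close>

lemma ex_power_first_above:
  fixes b x :: real
  assumes "1 < b" and "1 \<le> x"
  obtains m where "x \<le> b ^ m" and "b ^ m \<le> b * x"
proof -
  define m where "m = (LEAST n. x \<le> b ^ n)"
  have "\<exists>n. x \<le> b ^ n"
    using real_arch_pow[OF \<open>1 < b\<close>, of x] by (auto intro: less_imp_le)
  then have le: "x \<le> b ^ m"
    unfolding m_def by (rule LeastI_ex)
  have "b ^ m \<le> b * x"
  proof (cases m)
    case 0
    have "1 * 1 \<le> b * x"
      using assms by (intro mult_mono) auto
    then show ?thesis
      using 0 by simp
  next
    case (Suc n)
    then have "b ^ n < x"
      using not_less_Least[of n "\<lambda>n. x \<le> b ^ n"] by (simp add: m_def)
    then show ?thesis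
      using Suc assms by simp
  qed
  with le show thesis
    by (rule that)
qed

text \<open>Taking a real \<open>x\<close> in place of the quantile keeps the arithmetic in the
  reals; a finite quantile is one such \<open>x\<close>.\<close>

lemma expected_total_cutoff_geometric_le:
  assumes "prob_space p" and sets_p: "sets p = sets borel" and q: "0 < q" "q \<le> 1"
    and "1 \<le> x" and x: "q \<le> measure p {..ennreal x}"
  shows "expected_total_cutoff p (geometric_cutoffs q) \<le> ennreal (4 * x / q)"
proof -
  interpret prob_space p by fact
  define r where "r = 1 - q / 2"
  have "0 < r" and "r < 1"
    using q by (auto simp: r_def)
  then have b: "1 < 1 / r"
    by simp
  have S: "geometric_cutoffs q = (\<lambda>k. (1 / r) ^ k)"
    unfolding geometric_cutoffs_def r_def[symmetric]
    by (rule ext) (simp add: power_int_minus power_one_over inverse_eq_divide)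
  obtain m where m: "x \<le> (1 / r) ^ m" "(1 / r) ^ m \<le> 1 / r * x"
    using ex_power_first_above[OF b \<open>1 \<le> x\<close>] .
  let ?f = "\<lambda>j. emeasure p {ennreal ((1 / r) ^ j)<..}"
  have tail: "?f j \<le> ennreal (1 - q)" if "m \<le> j" for j
  proof -
    have "x \<le> (1 / r) ^ j"
      using m(1) power_increasing[OF that, of "1 / r"] b by linarith
    \<comment> \<open>A running time exceeding the cutoff of round \<open>j\<close> also exceeds
      \<open>x\<close>.\<close>
    then have "?f j \<le> emeasure p (space p - {..ennreal x})"
      using sets_eq_imp_space_eq[OF sets_p]
      by (intro emeasure_mono) (auto simp: sets_p not_le dest!: ennreal_leI[of x] intro: le_less_trans)
    also have "\<dots> = ennreal (1 - measure p {..ennreal x})"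
      by (simp add: emeasure_eq_measure prob_compl sets_p)
    also have "\<dots> \<le> ennreal (1 - q)"
      using x by (intro ennreal_leI) simp
    finally show ?thesis .
  qed
  have "expected_total_cutoff p (geometric_cutoffs q)
      = (\<Sum>k. ennreal ((1 / r) ^ k) * (\<Prod>j<k. ?f j))"
    unfolding S using b
    by (intro expected_total_cutoff_eq_suminf)
      (auto intro!: one_le_power simp: assms(1) sets_p simp del: power_one_over)
  also have "\<dots> \<le> (\<Sum>k. ennreal ((1 / r) ^ k * (1 - q) ^ (k - m)))"
  proof (intro suminf_le summableI)
    fix k
    have "(\<Prod>j<k. ?f j) \<le> ennreal (1 - q) ^ (k - m)"
      using tail by (intro prod_le_power_diff) (auto simp: emeasure_le_1)
    then show "ennreal ((1 / r) ^ k) * (\<Prod>j<k. ?f j) \<le> ennreal ((1 / r) ^ k * (1 - q) ^ (k - m))"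
      using q \<open>0 < r\<close> by (subst ennreal_mult) (auto simp: ennreal_power intro!: mult_left_mono)
  qed
  also have "\<dots> = ennreal (2 * r / q * (2 * (1 / r) ^ m - 1))"
    using q \<open>0 < r\<close> by (intro suminf_ennreal_eq delayed_geometric_sums) (auto simp: r_def)
  also have "\<dots> \<le> ennreal (4 * x / q)"
  proof (rule ennreal_leI)
    \<comment> \<open>The overshoot factor \<open>1 / r\<close> cancels against the \<open>r\<close>
      of the series value.\<close>
    have "2 * r / q * (2 * (1 / r) ^ m - 1) \<le> 2 * r / q * (2 * (1 / r * x))"
      using m(2) q \<open>0 < r\<close> by (intro mult_left_mono) auto
    also have "\<dots> = 4 * x / q"
      using \<open>0 < r\<close> by simp
    finally show "2 * r / q * (2 * (1 / r) ^ m - 1) \<le> 4 * x / q" .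
  qed
  finally show ?thesis .
qed

theorem theorem2:
  fixes M :: "'a measure" and T :: "'a \<Rightarrow> ennreal" and p :: "ennreal measure" and q :: real
  assumes "prob_space M"
    and "T \<in> borel_measurable M"
    and "\<And>\<omega>. \<omega> \<in> space M \<Longrightarrow> 1 \<le> T \<omega>"
    and "p = distr M borel T"
    and "0 < q" and "q \<le> 1"
  shows "expected_total_cutoff p (geometric_cutoffs q) \<le> 4 * (quantile p q / ennreal q)"
proof -
  have p: "prob_space p" and sets_p: "sets p = sets borel"
    using assms by (auto intro: prob_space.prob_space_distr)
  have Q: "1 \<le> quantile p q" "q \<le> measure p {..quantile p q}"
    using quantile_attained[OF p sets_p \<open>q \<le> 1\<close>] by auto
  show ?thesis
  proof (cases "quantile p q")
    case (real x)
    then have "1 \<le> x"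
      using Q(1) by simp
    then have "expected_total_cutoff p (geometric_cutoffs q) \<le> ennreal (4 * x / q)"
      using Q(2) real assms(5,6)
      by (intro expected_total_cutoff_geometric_le[OF p sets_p]) auto
    also have "\<dots> = 4 * (quantile p q / ennreal q)"
      using real \<open>0 < q\<close> by (simp add: divide_ennreal ennreal_mult' flip: times_divide_eq_right)
    finally show ?thesis .
  next
    \<comment> \<open>Since \<open>q\<close> is finite, the right-hand side is
      \<open>\<infinity>\<close>.\<close>
    case top
    then show ?thesis
      by (simp add: ennreal_top_divide ennreal_mult_top)
  qed
qed

end
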